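(* Let $B=(b_{ij})_{i,j=1}^n$ be a skew-symmetrizable integer matrix with skew-symmetrizer $D=\mathrm{diag}(d_1,\dots,d_n)$, let $k\in\{1,\dots,n\}$ and $\varepsilon\in\{+,-\}$. On the small phase space $M_0$ the Lagrangian $\mathscr{L}^{B}_{k,\varepsilon}$ (the Legendre transform of the Hamiltonian $H^{B}_{k,\varepsilon}$) depends only on $y_k^{\varepsilon}$, and, regarded as the function $\mathscr{L}^{B}_{k,\varepsilon}(y_k^{\varepsilon})$ of $y_k^{\varepsilon}$, it is given by the Rogers dilogarithm $\tilde L$ as $$\mathscr{L}^{B}_{k,\varepsilon}(y_k^{\varepsilon})=\frac{\varepsilon}{2d_k}\tilde{L}(y_k^{\varepsilon}).$$
   Context: Signs $\pm$ are identified with $\pm1$. $D$ is a skew-symmetrizer of $B$ if the $d_i$ are positive integers with $d_ib_{ij}=-d_jb_{ji}$. The phase space is $\mathbb{R}^{2n}$ with canonical coordinates $(u,p)$, and $w_i=\sum_jb_{ji}u_j$, $y_i=e^{d_ip_i+w_i}$. The Poisson bracket is $\{f,g\}=\sum_{i}(\frac{\partial f}{\partial p_i}\frac{\partial g}{\partial u_i}-\frac{\partial g}{\partial p_i}\frac{\partial f}{\partial u_i})$ and $\dot f=\{H,f\}$. Hamiltonian: $H^{B}_{k,\varepsilon}=\frac{\varepsilon}{2d_k}\mathrm{Li}_2(-y_k^{\varepsilon})$, where $\mathrm{Li}_2(-x)=-\int_0^x\frac{\log(1+y)}{y}dy$ for $x\ge -1$. The Lagrangian is $\mathscr{L}^{B}_{k,\varepsilon}=\sum_{i}\dot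 u_ip_i-H^{B}_{k,\varepsilon}$ with $\dot u_i=\partial H^{B}_{k,\varepsilon}/\partial p_i=-\frac12\delta_{ki}\log(1+y_k^{\varepsilon})$, i.e. as a function of $(u,p)$ $$\mathscr{L}^{B}_{k,\varepsilon}(u,p)=-\tfrac12\log(1+y_k^{\varepsilon})\,p_k-\tfrac{\varepsilon}{2d_k}\mathrm{Li}_2(-y_k^{\varepsilon}).$$ Small phase space: $M_0=\{(u,p)\mid d_ip_i=w_i,\ i=1,\dots,n\}$. Rogers dilogarithm: $\tilde L(x)=\frac12\int_0^x\left\{\frac{\log(1+y)}{y}-\frac{\log y}{1+y}\right\}dy$ for $x\ge0$. *)

theory Defs
  imports "HOL-Analysis.Analysis"
begin

definition skew_symmetrizer :: "('n::finite \<Rightarrow> int) \<Rightarrow> int^'n^'n \<Rightarrow> bool" where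
  "skew_symmetrizer d B \<longleftrightarrow>
     (\<forall>i. 0 < d i) \<and> (\<forall>i j. d i * B $ i $ j = - (d j * B $ j $ i))"

text \<open>A point of phase space is a pair \<open>(u, p)\<close>.\<close>

type_synonym 'n phase = "(real^'n) \<times> (real^'n)"

definition w_var :: "int^'n^'n \<Rightarrow> 'n::finite \<Rightarrow> 'n phase \<Rightarrow> real" where
  "w_var B i = (\<lambda>(u, p). \<Sum>j\<in>UNIV. of_int (B $ j $ i) * u $ j)"

definition y_var :: "int^'n^'n \<Rightarrow> ('n \<Rightarrow> int) \<Rightarrow> 'n::finite \<Rightarrow> 'n phase \<Rightarrow> real" where
  "y_var B d i = (\<lambda>(u, p). exp (of_int (d i) * p $ i + w_var B i (u, p)))"

definition partial_u :: "'n::finite \<Rightarrow> ('n phase \<Rightarrow> real) \<Rightarrow> 'n phase \<Rightarrow> real" where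
  "partial_u i f = (\<lambda>(u, p). deriv (\<lambda>t. f (u + t *\<^sub>R axis i 1, p)) 0)"

definition partial_p :: "'n::finite \<Rightarrow> ('n phase \<Rightarrow> real) \<Rightarrow> 'n phase \<Rightarrow> real" where
  "partial_p i f = (\<lambda>(u, p). deriv (\<lambda>t. f (u, p + t *\<^sub>R axis i 1)) 0)"

definition poisson_bracket ::
    "('n::finite phase \<Rightarrow> real) \<Rightarrow> ('n phase \<Rightarrow> real) \<Rightarrow> 'n phase \<Rightarrow> real" where
  "poisson_bracket f g z =
     (\<Sum>i\<in>UNIV. partial_p i f z * partial_u i g z - partial_p i g z * partial_u i f z)"

text \<open>The dilogarithm on the real half-line \<open>z \<le> 1\<close>, i.e. \<open>z = -x\<close> with \<open>x \<ge> -1\<close>; only these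
  values are meaningful. The interval integral is oriented, so \<open>x < 0\<close> is covered.\<close>

definition Li2 :: "real \<Rightarrow> real" where
  "Li2 z = - (LBINT y=0..ereal (- z). ln (1 + y) / y)"

text \<open>The (modified) Rogers dilogarithm; only the values at \<open>x \<ge> 0\<close> are meaningful.\<close>

definition Rogers_L :: "real \<Rightarrow> real" where
  "Rogers_L x = 1/2 * (LBINT y=0..ereal x. (ln (1 + y) / y - ln y / (1 + y)))"

text \<open>Signs are the integers \<open>1\<close> and \<open>-1\<close>.\<close>

definition Hamiltonian ::
    "int^'n^'n \<Rightarrow> ('n \<Rightarrow> int) \<Rightarrow> 'n::finite \<Rightarrow> int \<Rightarrow> 'n phase \<Rightarrow> real" where
  "Hamiltonian B d k \<epsilon> z =
     of_int \<epsilon> / (2 * of_int (d k)) * Li2 (- (y_var B d k z powi \<epsilon>))"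

text \<open>The time derivative of an observable \<open>f\<close> under the flow of a Hamiltonian \<open>H\<close>.\<close>

definition time_deriv ::
    "('n::finite phase \<Rightarrow> real) \<Rightarrow> ('n phase \<Rightarrow> real) \<Rightarrow> 'n phase \<Rightarrow> real" where
  "time_deriv H f = poisson_bracket H f"

definition Legendre_transform :: "('n::finite phase \<Rightarrow> real) \<Rightarrow> 'n phase \<Rightarrow> real" where
  "Legendre_transform H z =
     (\<Sum>i\<in>UNIV. time_deriv H (\<lambda>(u, p). u $ i) z * snd z $ i) - H z"

definition Lagrangian ::
    "int^'n^'n \<Rightarrow> ('n \<Rightarrow> int) \<Rightarrow> 'n::finite \<Rightarrow> int \<Rightarrow> 'n phase \<Rightarrow> real" where
  "Lagrangian B d k \<epsilon> = Legendre_transform (Hamiltonian B d k \<epsilon>)"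

definition small_phase_space ::
    "int^'n^'n \<Rightarrow> ('n \<Rightarrow> int) \<Rightarrow> 'n::finite phase set" where
  "small_phase_space B d = {(u, p). \<forall>i. of_int (d i) * p $ i = w_var B i (u, p)}"

end

theory Submission
  imports Defs "HOL-Real_Asymp.Real_Asymp"
begin

text \<open>
  Write \<open>Y = y\<^sub>k\<^sup>\<epsilon>\<close>. Among the momenta, \<open>H\<close> involves only \<open>p\<^sub>k\<close>, and the chain rule with
  \<open>d/dx Li2(-x) = - ln(1+x)/x\<close> gives the velocities \<open>\<partial>H/\<partial>p\<^sub>i = - \<delta>\<^sub>k\<^sub>i ln(1+Y)/2\<close>
  (\<open>partial_p_Hamiltonian\<close>). So the Lagrangian is
  \<open>- ln(1+Y) p\<^sub>k / 2 - \<epsilon>/(2 d\<^sub>k) Li2(-Y)\<close> everywhere on phase space. On the small phase space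
  \<open>w\<^sub>k = d\<^sub>k p\<^sub>k\<close>, so \<open>Y = exp(2 \<epsilon> d\<^sub>k p\<^sub>k)\<close> determines the one remaining coordinate,
  \<open>p\<^sub>k = \<epsilon>/(2 d\<^sub>k) ln Y\<close> (\<open>momentum_on_small_phase_space\<close>), and the Lagrangian becomes
  \<open>\<epsilon>/(2 d\<^sub>k) (- Li2(-Y) - ln Y ln(1+Y) / 2)\<close>.
  The bracket is the Rogers dilogarithm of \<open>Y\<close>: integrating \<open>ln y/(1+y)\<close> by parts turns the second half
  of its integrand into another copy of \<open>ln(1+y)/y\<close>, at the cost of the boundary term
  \<open>ln Y ln(1+Y)\<close> (lemma \<open>Rogers_L_eq_Li2\<close>).

  Two analytic points need care because the integrals start at \<open>0\<close>, where \<open>ln(1+y)/y\<close> is an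
  undefined quotient and \<open>ln y/(1+y)\<close> is unbounded. The first has a removable singularity, so it is
  replaced by its continuous extension. For the second, \<open>ln y\<close> is compared with its value at the upper
  limit: \<open>(ln x - ln y)/(1+y)\<close> is nonnegative on \<open>(0,x)\<close>, so that the limits of an
  antiderivative at both ends give integrability and value at once.
\<close>

section \<open>The dilogarithm on the negative half-line\<close>

text \<open>
  Since \<open>ln(1+y)/y\<close> tends to \<open>1\<close> at \<open>0\<close>, the value \<open>1\<close> there repairs the default value \<open>0\<close>
  of the quotient and makes the fundamental theorem applicable on closed intervals starting at \<open>0\<close>.
\<close>

lemma continuous_on_dilog_integrand:
  "continuous_on {0..b} (\<lambda>y::real. if y = 0 then 1 else ln (1 + y) / y)"
proof (rule continuous_at_imp_continuous_on, rule ballI)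
  fix y :: real
  assume y: "y \<in> {0..b}"
  show "isCont (\<lambda>y::real. if y = 0 then 1 else ln (1 + y) / y) y"
  proof (cases "y = 0")
    case True
    have "((\<lambda>y::real. ln (1 + y) / y) \<longlongrightarrow> 1) (at 0)"
      by real_asymp
    then have "((\<lambda>y::real. if y = 0 then 1 else ln (1 + y) / y) \<longlongrightarrow> 1) (at 0)"
      by (rule Lim_transform_eventually) (auto simp: eventually_at_filter)
    with True show ?thesis
      by (simp add: isCont_def)
  next
    case False
    with y have "isCont (\<lambda>y::real. ln (1 + y) / y) y"
      by (auto intro!: continuous_intros)
    moreover have "\<forall>\<^sub>F t in nhds y. t \<noteq> 0"
      using False by (rule t1_space_nhds)
    then have "\<forall>\<^sub>F t in nhds y. (if t = 0 then 1 else ln (1 + t) / t) = ln (1 + t) / t"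
      by (rule eventually_mono) simp
    ultimately show ?thesis
      using isCont_cong by fast
  qed
qed

lemma dilog_integrable:
  assumes "0 < x"
  shows "interval_lebesgue_integrable lborel 0 (ereal x) (\<lambda>y. ln (1 + y) / y)"
proof -
  have "interval_lebesgue_integrable lborel (ereal 0) (ereal x)
          (\<lambda>y. if y = 0 then 1 else ln (1 + y) / y)"
    using assms by (intro interval_integrable_continuous_on continuous_on_dilog_integrand) simp
  then have "set_integrable lborel {0<..<x} (\<lambda>y. if y = 0 then 1 else ln (1 + y) / y)"
    using assms by (simp add: interval_lebesgue_integrable_def)
  also have "?this \<longleftrightarrow> set_integrable lborel {0<..<x} (\<lambda>y. ln (1 + y) / y)"
    by (intro set_integrable_cong) auto
  finally show ?thesis
    using assms by (simp add: interval_lebesgue_integrable_def zero_ereal_def)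
qed

text \<open>
  The integral ignores the endpoint \<open>0\<close>, so the continuous extension of the integrand may be used.
  Including \<open>x = 0\<close> yields continuity of the dilogarithm there from the right, which is needed for the
  boundary term at \<open>0\<close> in \<open>log_quotient_integral\<close>.
\<close>

lemma Li2_minus_has_vector_derivative_within:
  assumes "0 \<le> x" "x \<le> b"
  shows "((\<lambda>x. Li2 (- x)) has_vector_derivative - (if x = 0 then 1 else ln (1 + x) / x))
           (at x within {0..b})"
proof -
  let ?g = "\<lambda>y::real. if y = 0 then 1 else ln (1 + y) / y"
  have "((\<lambda>x. LBINT y=0..x. ?g y) has_vector_derivative ?g x) (at x within {0..b})"
    using interval_integral_FTC2[of 0 0 b ?g x] assms continuous_on_dilog_integrand[of b]
    by (simp add: zero_ereal_def)
  then have "((\<lambda>x. - (LBINT y=0..x. ?g y)) has_vector_derivative - ?g x) (at x within {0..b})"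
    by (rule has_vector_derivative_minus)
  moreover have "- (LBINT y=0..x. ?g y) = Li2 (- x)" if "x \<in> {0..b}" for x
    using that unfolding Li2_def
    by (auto intro!: interval_integral_cong simp: zero_ereal_def min_def max_def)
  ultimately show ?thesis
    using assms by (auto intro: has_vector_derivative_transform[rotated 2])
qed

lemma Li2_minus_has_real_derivative:
  assumes "0 < x"
  shows "((\<lambda>x. Li2 (- x)) has_real_derivative - (ln (1 + x) / x)) (at x)"
proof -
  have "((\<lambda>x. Li2 (- x)) has_real_derivative - (ln (1 + x) / x)) (at x within {0..x+1})"
    using Li2_minus_has_vector_derivative_within[of x "x + 1"] assms
    by (simp add: has_real_derivative_iff_has_vector_derivative)
  moreover have "at x within {0..x+1} = at x"
    using assms by (intro at_within_interior) auto
  ultimately show ?thesis by simp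
qed

lemma Li2_minus_tendsto_0: "((\<lambda>x. Li2 (- x)) \<longlongrightarrow> 0) (at_right 0)"
proof -
  have "continuous (at 0 within {0..1}) (\<lambda>x. Li2 (- x))"
    using Li2_minus_has_vector_derivative_within[of 0 1] has_vector_derivative_continuous by fastforce
  moreover have "Li2 0 = 0"
    by (simp add: Li2_def zero_ereal_def[symmetric])
  ultimately have "((\<lambda>x. Li2 (- x)) \<longlongrightarrow> 0) (at 0 within {0..1})"
    by (simp add: continuous_within)
  then show ?thesis
    by (simp add: at_within_Icc_at_right)
qed

section \<open>The Rogers dilogarithm\<close>

text \<open>
  This is the integration by parts that exchanges \<open>ln y/(1+y)\<close> for \<open>ln(1+y)/y\<close>. The summand \<open>ln x\<close>
  gives the integrand a constant sign and also makes the boundary term vanish at the upper limit.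
\<close>

lemma log_quotient_integral:
  assumes x: "0 < x"
  shows "interval_lebesgue_integrable lborel 0 (ereal x) (\<lambda>y. (ln x - ln y) / (1 + y))"
    and "(LBINT y=0..ereal x. (ln x - ln y) / (1 + y)) = - Li2 (- x)"
proof -
  \<comment> \<open>Differentiating the product produces \<open>- ln(1+y)/y\<close>, which the dilogarithm term cancels.\<close>
  define F where "F y = (ln x - ln y) * ln (1 + y) - Li2 (- y)" for y
  have F': "DERIV F y :> (ln x - ln y) / (1 + y)" if "0 < y" for y
  proof -
    have "DERIV F y :> (0 - 1 / y) * ln (1 + y) + 1 / (1 + y) * (ln x - ln y) - (- (ln (1 + y) / y))"
      unfolding F_def using that
      by (intro DERIV_diff DERIV_mult Li2_minus_has_real_derivative)
         (auto intro!: derivative_eq_intros)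
    then show ?thesis by simp
  qed
  have "((\<lambda>y. (ln x - ln y) * ln (1 + y)) \<longlongrightarrow> 0) (at_right 0)"
    by real_asymp
  from tendsto_diff[OF this Li2_minus_tendsto_0] have F0: "(F \<longlongrightarrow> 0) (at_right 0)"
    by (simp add: F_def[abs_def])
  have "isCont F x"
    using F'[OF x] by (rule DERIV_isCont)
  then have Fx: "(F \<longlongrightarrow> - Li2 (- x)) (at_left x)"
    by (simp add: isCont_def F_def filterlim_at_split)
  have cont: "isCont (\<lambda>y. (ln x - ln y) / (1 + y)) y" if "0 < y" for y
    using that by (auto intro!: continuous_intros)
  note FTC = interval_integral_FTC_nonneg[of "ereal 0" "ereal x" F
      "\<lambda>y. (ln x - ln y) / (1 + y)" 0 "- Li2 (- x)"]
  have "set_integrable lborel (einterval (ereal 0) (ereal x)) (\<lambda>y. (ln x - ln y) / (1 + y)) \<and>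
        (LBINT y=ereal 0..ereal x. (ln x - ln y) / (1 + y)) = - Li2 (- x)"
    using FTC x F' F0 Fx cont
    by (auto simp: ereal_tendsto_simps)
  then show "interval_lebesgue_integrable lborel 0 (ereal x) (\<lambda>y. (ln x - ln y) / (1 + y))"
    and "(LBINT y=0..ereal x. (ln x - ln y) / (1 + y)) = - Li2 (- x)"
    using x by (simp_all add: interval_lebesgue_integrable_def zero_ereal_def)
qed

lemma inverse_shift_integral:
  assumes x: "0 < x"
  shows "interval_lebesgue_integrable lborel 0 (ereal x) (\<lambda>y. 1 / (1 + y))"
    and "(LBINT y=0..ereal x. 1 / (1 + y)) = ln (1 + x)"
proof -
  have cont: "continuous_on {0..x} (\<lambda>y. 1 / (1 + y))"
    by (auto intro!: continuous_intros)
  show "interval_lebesgue_integrable lborel 0 (ereal x) (\<lambda>y. 1 / (1 + y))"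
    using interval_integrable_continuous_on[OF _ cont] x by (simp add: zero_ereal_def)
  have "(LBINT y=ereal 0..ereal x. 1 / (1 + y)) = ln (1 + x) - ln (1 + 0)"
    using x cont
    by (intro interval_integral_FTC_finite)
       (auto intro!: derivative_eq_intros
         simp: has_real_derivative_iff_has_vector_derivative[symmetric])
  then show "(LBINT y=0..ereal x. 1 / (1 + y)) = ln (1 + x)"
    by (simp add: zero_ereal_def)
qed

text \<open>
  The integrand is a combination of three integrable functions on \<open>(0,x)\<close>: two of them integrate to
  \<open>- Li2(-x)\<close>, and the third compensates for the constant \<open>ln x\<close>.
\<close>

lemma Rogers_L_eq_Li2:
  assumes x: "0 < x"
  shows "Rogers_L x = - Li2 (- x) - ln x * ln (1 + x) / 2"
proof -
  note int = dilog_integrable[OF x] log_quotient_integral[OF x] inverse_shift_integral[OF x]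
  have "ln (1 + y) / y - ln y / (1 + y) =
          ln (1 + y) / y + (ln x - ln y) / (1 + y) - ln x * (1 / (1 + y))" for y
    by (simp add: diff_divide_distrib)
  then have "(LBINT y=0..ereal x. (ln (1 + y) / y - ln y / (1 + y))) =
      (LBINT y=0..ereal x. (ln (1 + y) / y + (ln x - ln y) / (1 + y) - ln x * (1 / (1 + y))))"
    by presburger
  also have "\<dots> = (LBINT y=0..ereal x. ln (1 + y) / y)
      + (LBINT y=0..ereal x. (ln x - ln y) / (1 + y)) - ln x * (LBINT y=0..ereal x. 1 / (1 + y))"
    using int by (simp del: times_divide_eq_right mult_1_right)
  also have "\<dots> = - 2 * Li2 (- x) - ln x * ln (1 + x)"
    using int by (simp add: Li2_def)
  finally show ?thesis
    by (simp add: Rogers_L_def field_simps)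
qed

section \<open>The Lagrangian\<close>

lemma y_var_pos: "0 < y_var B d k z"
  by (cases z) (simp add: y_var_def)

lemma y_var_powi:
  "y_var B d k (u, p) powi \<epsilon> = exp (of_int \<epsilon> * (of_int (d k) * p $ k + w_var B k (u, p)))"
  by (simp add: y_var_def exp_power_int)

text \<open>
  A shift of \<open>p\<^sub>i\<close> leaves every \<open>w\<^sub>j\<close> fixed, so it multiplies \<open>y\<^sub>k\<^sup>\<epsilon>\<close> by an exponential if
  \<open>i = k\<close> and has no effect otherwise. In the chain rule the inner derivative \<open>\<epsilon> d\<^sub>k y\<^sub>k\<^sup>\<epsilon>\<close> cancels
  the denominator of \<open>ln(1+x)/x\<close> and, as \<open>\<epsilon>\<^sup>2 = 1\<close>, the prefactor of \<open>H\<close> up to \<open>1/2\<close>.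
\<close>

lemma partial_p_Hamiltonian:
  assumes d: "0 < d k" and \<epsilon>: "\<epsilon> \<in> {1, -1}"
  shows "partial_p i (Hamiltonian B d k \<epsilon>) z =
           (if i = k then - (1/2) * ln (1 + y_var B d k z powi \<epsilon>) else 0)"
proof (cases z)
  case (Pair u p)
  let ?Y = "y_var B d k z powi \<epsilon>"
  have Y: "0 < ?Y"
    by (simp add: y_var_pos)
  have shift: "y_var B d k (u, p + t *\<^sub>R axis i 1) powi \<epsilon> =
      ?Y * exp (if i = k then of_int \<epsilon> * of_int (d k) * t else 0)" for t
    by (simp add: Pair y_var_powi w_var_def exp_add[symmetric] axis_def algebra_simps)
  show ?thesis
  proof (cases "i = k")
    case True
    have "((\<lambda>t. ?Y * exp (of_int \<epsilon> * of_int (d k) * t)) has_real_derivative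
            ?Y * (of_int \<epsilon> * of_int (d k))) (at 0)"
      by (auto intro!: derivative_eq_intros)
    moreover have "((\<lambda>x. Li2 (- x)) has_real_derivative - (ln (1 + ?Y) / ?Y))
        (at (?Y * exp (of_int \<epsilon> * of_int (d k) * 0)))"
      using Li2_minus_has_real_derivative[OF Y] by simp
    ultimately have "((\<lambda>t. Li2 (- (?Y * exp (of_int \<epsilon> * of_int (d k) * t)))) has_real_derivative
        - (ln (1 + ?Y) / ?Y) * (?Y * (of_int \<epsilon> * of_int (d k)))) (at 0)"
      by (rule DERIV_chain2[rotated])
    from DERIV_cmult[OF this, of "of_int \<epsilon> / (2 * of_int (d k))"]
    have "((\<lambda>t. Hamiltonian B d k \<epsilon> (u, p + t *\<^sub>R axis i 1)) has_real_derivative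
        of_int \<epsilon> / (2 * of_int (d k)) * (- (ln (1 + ?Y) / ?Y) * (?Y * (of_int \<epsilon> * of_int (d k)))))
        (at 0)"
      by (simp only: Hamiltonian_def shift if_P[OF True])
    moreover have "of_int \<epsilon> / (2 * of_int (d k)) *
        (- (ln (1 + ?Y) / ?Y) * (?Y * (of_int \<epsilon> * of_int (d k)))) = - (1/2) * ln (1 + ?Y)"
      using \<epsilon> d Y by (auto simp: field_simps)
    ultimately show ?thesis
      using True Pair by (simp add: partial_p_def DERIV_imp_deriv)
  next
    case False
    then have "Hamiltonian B d k \<epsilon> (u, p + t *\<^sub>R axis i 1) = Hamiltonian B d k \<epsilon> z" for t
      by (simp add: Hamiltonian_def shift)
    then show ?thesis
      using False Pair by (simp add: partial_p_def)
  qed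
qed

lemma time_deriv_u: "time_deriv H (\<lambda>(u, p). u $ i) z = partial_p i H z"
proof (cases z)
  case (Pair u p)
  have "partial_p j (\<lambda>(u, p). u $ i) z = 0" for j
    by (simp add: Pair partial_p_def)
  moreover have "partial_u j (\<lambda>(u, p). u $ i) z = (if j = i then 1 else 0)" for j
  proof -
    have "((\<lambda>t. u $ i + t * axis j 1 $ i) has_real_derivative axis j 1 $ i) (at 0)"
      by (auto intro!: derivative_eq_intros)
    from DERIV_imp_deriv[OF this] show ?thesis
      by (simp add: Pair partial_u_def axis_def)
  qed
  ultimately show ?thesis
    by (simp add: time_deriv_def poisson_bracket_def if_distrib[of "\<lambda>c. _ * c"] cong: if_cong)
qed

lemma Lagrangian_eq:
  assumes "0 < d k" and "\<epsilon> \<in> {1, -1}"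
  shows "Lagrangian B d k \<epsilon> z = - (1/2) * ln (1 + y_var B d k z powi \<epsilon>) * snd z $ k
           - of_int \<epsilon> / (2 * of_int (d k)) * Li2 (- (y_var B d k z powi \<epsilon>))"
  using assms
  by (simp add: Lagrangian_def Legendre_transform_def time_deriv_u partial_p_Hamiltonian
      Hamiltonian_def if_distrib[of "\<lambda>c. c * _"] cong: if_cong)

text \<open>
  The constraint \<open>d\<^sub>k p\<^sub>k = w\<^sub>k\<close> doubles the exponent of \<open>y\<^sub>k\<close>, which is then a function of \<open>p\<^sub>k\<close>
  alone and can be inverted. This is the step that makes the Lagrangian depend on \<open>y\<^sub>k\<^sup>\<epsilon>\<close> only.
\<close>

lemma momentum_on_small_phase_space:
  assumes d: "0 < d k" and \<epsilon>: "\<epsilon> \<in> {1, -1}" and z: "z \<in> small_phase_space B d"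
  shows "snd z $ k = of_int \<epsilon> / (2 * of_int (d k)) * ln (y_var B d k z powi \<epsilon>)"
proof (cases z)
  case (Pair u p)
  with z have "w_var B k (u, p) = of_int (d k) * p $ k"
    by (simp add: small_phase_space_def)
  then show ?thesis
    using d \<epsilon> by (auto simp: Pair y_var_powi)
qed

lemma Lagrangian_on_small_phase_space:
  assumes "0 < d k" and "\<epsilon> \<in> {1, -1}" and "z \<in> small_phase_space B d"
  shows "Lagrangian B d k \<epsilon> z =
           of_int \<epsilon> / (2 * of_int (d k)) * Rogers_L (y_var B d k z powi \<epsilon>)"
proof -
  have "0 < y_var B d k z powi \<epsilon>"
    by (simp add: y_var_pos)
  then show ?thesis
    by (simp add: Lagrangian_eq[of d k, OF assms(1,2)] momentum_on_small_phase_space[of d k, OF assms]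
        Rogers_L_eq_Li2 right_diff_distrib)
qed

theorem proposition4p4:
  fixes B :: "int^'n^'n" and d :: "'n::finite \<Rightarrow> int" and k :: 'n and \<epsilon> :: int
  assumes "skew_symmetrizer d B"
    and "\<epsilon> \<in> {1, -1}"
  shows "(\<forall>z\<in>small_phase_space B d. \<forall>z'\<in>small_phase_space B d.
            y_var B d k z powi \<epsilon> = y_var B d k z' powi \<epsilon> \<longrightarrow>
            Lagrangian B d k \<epsilon> z = Lagrangian B d k \<epsilon> z') \<and>
         (\<forall>z\<in>small_phase_space B d.
            Lagrangian B d k \<epsilon> z =
              of_int \<epsilon> / (2 * of_int (d k)) * Rogers_L (y_var B d k z powi \<epsilon>))"
proof -
  have "0 < d k"
    using assms(1) by (simp add: skew_symmetrizer_def)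
  note L = Lagrangian_on_small_phase_space[of d k \<epsilon> _ B, OF this assms(2)]
  show ?thesis
    by (simp add: L)
qed

end
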